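(* Let $d\ge 2$ and let $u_0\in L^1(\mathbb{R}^d)\cap L^{\infty}(\mathbb{R}^d)$ be real-valued with $\|u_0\|_{L^1}\neq 0$, and suppose that $$\int_{\mathbb{R}^d} e^{\langle\lambda,y\rangle}|u_0(y)|\,dy<\infty\quad\text{for all }\lambda\in\mathbb{R}^d.$$ Assume that $\mathcal{N}(U_0)\neq\emptyset$. Then for every $\eta^{*}\in\mathcal{N}(U_0)$ with multiplicity $1$, there exist $T>0$ and points $x^{*}(t)\in\mathcal{Z}(t)$, defined for all $t>T$, such that $$x^{*}(t)=2t\eta^{*}+\frac{\Delta_{\eta}U_0(\eta^{*})}{2|\nabla_{\eta}U_0(\eta^{*})|^2}\nabla_{\eta}U_0(\eta^{*})+o(1)\qquad(t\to+\infty).$$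
   Context: $|\cdot|$ and $\langle\cdot,\cdot\rangle$ denote the Euclidean norm and inner product on $\mathbb{R}^d$. Let $u$ be the unique bounded solution of the heat equation $\partial_t u=\Delta_x u$ ($t>0$, $x\in\mathbb{R}^d$) with $u(0,x)=u_0(x)$, i.e. $u(t,x)=\int_{\mathbb{R}^d}G(t,x-y)u_0(y)\,dy$ with $G(t,x)=(4\pi t)^{-d/2}e^{-|x|^2/(4t)}$. The zero level set is $\mathcal{Z}(t):=\{x\in\mathbb{R}^d\mid u(t,x)=0\}$. The bilateral Laplace transform of $u_0$ is $U_0(\eta):=\int_{\mathbb{R}^d}e^{\langle\eta,y\rangle}u_0(y)\,dy$, $\eta\in\mathbb{R}^d$, and $\mathcal{N}(U_0):=\{\eta\in\mathbb{R}^d\mid U_0(\eta)=0\}$. A point $\eta^{*}\in\mathcal{N}(U_0)$ has multiplicity $1$ if some first-order partial derivative of $U_0$ does not vanish at $\eta^{*}$, i.e. $\nabla_\eta U_0(\eta^{*})\neq 0$. *)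

theory Defs
  imports "HOL-Analysis.Analysis"
begin

definition heat_kernel :: "real \<Rightarrow> real ^ 'd \<Rightarrow> real" where
  "heat_kernel t x =
     (4 * pi * t) powr (- (real CARD('d) / 2)) * exp (- (norm x)\<^sup>2 / (4 * t))"

text \<open>The bounded solution of the heat equation with initial value \<open>u0\<close>, for \<open>t > 0\<close>.\<close>

definition heat_solution :: "(real ^ 'd \<Rightarrow> real) \<Rightarrow> real \<Rightarrow> real ^ 'd \<Rightarrow> real" where
  "heat_solution u0 t x = (LINT y|lebesgue. heat_kernel t (x - y) * u0 y)"

definition zero_level_set :: "(real ^ 'd \<Rightarrow> real) \<Rightarrow> real \<Rightarrow> (real ^ 'd) set" where
  "zero_level_set u0 t = {x. heat_solution u0 t x = 0}"

definition bilateral_laplace :: "(real ^ 'd \<Rightarrow> real) \<Rightarrow> real ^ 'd \<Rightarrow> real" where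
  "bilateral_laplace u0 \<eta> = (LINT y|lebesgue. exp (\<eta> \<bullet> y) * u0 y)"

definition zero_set :: "(real ^ 'd \<Rightarrow> real) \<Rightarrow> (real ^ 'd) set" where
  "zero_set F = {\<eta>. F \<eta> = 0}"

text \<open>\<^const>\<open>deriv\<close> is unspecified where the derivative does not exist. Below, the operators are
  only applied to \<^const>\<open>bilateral_laplace\<close> of functions all of whose exponential moments are
  finite, which is smooth.\<close>

definition partial_deriv :: "'d \<Rightarrow> (real ^ 'd \<Rightarrow> real) \<Rightarrow> real ^ 'd \<Rightarrow> real" where
  "partial_deriv i f x = deriv (\<lambda>s. f (x + s *\<^sub>R axis i 1)) 0"

definition grad :: "(real ^ 'd \<Rightarrow> real) \<Rightarrow> real ^ 'd \<Rightarrow> real ^ 'd" where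
  "grad f x = (\<chi> i. partial_deriv i f x)"

definition laplacian :: "(real ^ 'd \<Rightarrow> real) \<Rightarrow> real ^ 'd \<Rightarrow> real" where
  "laplacian f x = (\<Sum>i\<in>UNIV. partial_deriv i (partial_deriv i f) x)"

definition multiplicity_one :: "(real ^ 'd \<Rightarrow> real) \<Rightarrow> real ^ 'd \<Rightarrow> bool" where
  "multiplicity_one F \<eta> \<longleftrightarrow> \<eta> \<in> zero_set F \<and> (\<exists>i. partial_deriv i F \<eta> \<noteq> 0)"

end

theory Submission
  imports Defs
begin

text \<open>With \<open>s = 1/(2t)\<close> and \<open>x = 2t\<eta> + z\<close>, completing the square turns \<open>u(t,x) = 0\<close> into
  \<open>H(s,z) = 0\<close> for \<open>H(s,z) = \<integral> exp(\<eta>\<bullet>y) exp(s (z\<bullet>y - |y|\<^sup>2/2)) u0(y) dy\<close>. Since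
  \<open>H(0,z) = U0(\<eta>) = 0\<close>, dominated convergence gives
  \<open>H(s,z)/s \<longrightarrow> z\<bullet>\<nabla>U0(\<eta>) - \<Delta>U0(\<eta>)/2\<close> as \<open>s\<close> decreases to \<open>0\<close>. On the line
  \<open>z = (c + r) \<nabla>U0(\<eta>)\<close> with \<open>c = \<Delta>U0(\<eta>) / (2 |\<nabla>U0(\<eta>)|\<^sup>2)\<close> this limit is
  \<open>r |\<nabla>U0(\<eta>)|\<^sup>2\<close>, so for each \<open>e > 0\<close> the intermediate value theorem yields a zero with
  \<open>|r| \<le> e\<close> once \<open>s\<close> is small. Zeros of almost minimal \<open>|r|\<close> therefore satisfy \<open>r = o(1)\<close>.\<close>

section \<open>Functions with finite exponential moments\<close>

text \<open>The class contains \<open>u0\<close> and is closed under factors of at most exponential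
  growth, hence under the factors produced by differentiating a Laplace transform. Measurability is
  a separate conjunct because integrability of the weighted absolute values does not give
  measurability of \<open>f\<close> itself.\<close>

definition exp_moments :: "(real ^ 'd \<Rightarrow> real) \<Rightarrow> bool" where
  "exp_moments f \<longleftrightarrow> f \<in> borel_measurable lebesgue \<and>
     (\<forall>l. integrable lebesgue (\<lambda>y. exp (l \<bullet> y) * \<bar>f y\<bar>))"

lemma borel_measurable_lebesgue_ident [measurable]:
  "(\<lambda>y::real ^ 'd. y) \<in> borel_measurable lebesgue"
  by (rule measurable_completion) simp

text \<open>The norm is at most the dimension times the largest coordinate modulus, and the
  exponential of a modulus is one of the two signed exponentials. This replaces the radial weight by
  finitely many weights \<open>exp (l \<bullet> y)\<close>, the only ones that
  \<open>exp_moments\<close> controls.\<close>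

lemma exp_norm_le_sum:
  fixes y :: "real ^ 'd"
  assumes "K \<ge> 0"
  shows "exp (K * norm y) \<le> (\<Sum>i\<in>UNIV. exp ((axis i (K * real CARD('d))) \<bullet> y)
           + exp ((axis i (- K * real CARD('d))) \<bullet> y))"
proof -
  have "Max (range (\<lambda>i. \<bar>y $ i\<bar>)) \<in> range (\<lambda>i. \<bar>y $ i\<bar>)"
    by (rule Max_in) auto
  then obtain j where "Max (range (\<lambda>i. \<bar>y $ i\<bar>)) = \<bar>y $ j\<bar>"
    unfolding image_iff by blast
  then have j: "\<bar>y $ i\<bar> \<le> \<bar>y $ j\<bar>" for i
    by (metis Max_ge finite finite_imageI rangeI)
  have "norm y \<le> (\<Sum>i\<in>UNIV. \<bar>y $ i\<bar>)"
    by (rule norm_le_l1_cart)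
  also have "\<dots> \<le> real CARD('d) * \<bar>y $ j\<bar>"
    using sum_bounded_above[of UNIV "\<lambda>i. \<bar>y $ i\<bar>" "\<bar>y $ j\<bar>"] j by simp
  finally have "exp (K * norm y) \<le> exp (K * (real CARD('d) * \<bar>y $ j\<bar>))"
    using assms by (simp add: mult_left_mono)
  also have "\<dots> \<le> exp ((axis j (K * real CARD('d))) \<bullet> y) + exp ((axis j (- K * real CARD('d))) \<bullet> y)"
    by (cases "y $ j \<ge> 0") (simp_all add: inner_axis' mult.assoc)
  also have "\<dots> \<le> (\<Sum>i\<in>UNIV. exp ((axis i (K * real CARD('d))) \<bullet> y)
           + exp ((axis i (- K * real CARD('d))) \<bullet> y))"
    by (rule member_le_sum[of j UNIV "\<lambda>i. exp ((axis i (K * real CARD('d))) \<bullet> y)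
           + exp ((axis i (- K * real CARD('d))) \<bullet> y)"]) (auto intro: add_nonneg_nonneg)
  finally show ?thesis .
qed

text \<open>After the bound of the radial weight by exponentials of linear forms, the factor
  \<open>exp (l \<bullet> y)\<close> only shifts their frequencies, so each summand is one of the
  assumed moments.\<close>

lemma exp_moments_integrable_exp_norm:
  fixes f :: "real ^ 'd \<Rightarrow> real"
  assumes f: "exp_moments f" and K: "K \<ge> 0"
  shows "integrable lebesgue (\<lambda>y. exp (l \<bullet> y) * (exp (K * norm y) * \<bar>f y\<bar>))"
proof (rule Bochner_Integration.integrable_bound)
  have [measurable]: "f \<in> borel_measurable lebesgue"
    using f by (simp add: exp_moments_def)
  let ?a = "\<lambda>i::'d. axis i (K * real CARD('d)) :: real ^ 'd"
  let ?b = "\<lambda>i::'d. axis i (- K * real CARD('d)) :: real ^ 'd"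
  show "integrable lebesgue (\<lambda>y. \<Sum>i\<in>UNIV. exp ((l + ?a i) \<bullet> y) * \<bar>f y\<bar> + exp ((l + ?b i) \<bullet> y) * \<bar>f y\<bar>)"
    using f unfolding exp_moments_def by (intro Bochner_Integration.integrable_sum Bochner_Integration.integrable_add) blast+
  show "(\<lambda>y. exp (l \<bullet> y) * (exp (K * norm y) * \<bar>f y\<bar>)) \<in> borel_measurable lebesgue"
    by measurable
  have "norm (exp (l \<bullet> y) * (exp (K * norm y) * \<bar>f y\<bar>))
      \<le> norm (\<Sum>i\<in>UNIV. exp ((l + ?a i) \<bullet> y) * \<bar>f y\<bar> + exp ((l + ?b i) \<bullet> y) * \<bar>f y\<bar>)" for y
  proof -
    have "exp (l \<bullet> y) * (exp (K * norm y) * \<bar>f y\<bar>)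
        \<le> exp (l \<bullet> y) * ((\<Sum>i\<in>UNIV. exp (?a i \<bullet> y) + exp (?b i \<bullet> y)) * \<bar>f y\<bar>)"
      using exp_norm_le_sum[OF K, of y] by (intro mult_left_mono mult_right_mono) auto
    also have "\<dots> = (\<Sum>i\<in>UNIV. exp ((l + ?a i) \<bullet> y) * \<bar>f y\<bar> + exp ((l + ?b i) \<bullet> y) * \<bar>f y\<bar>)"
      by (simp add: sum_distrib_left sum_distrib_right inner_add_left exp_add algebra_simps)
    finally have "exp (l \<bullet> y) * (exp (K * norm y) * \<bar>f y\<bar>)
      \<le> (\<Sum>i\<in>UNIV. exp ((l + ?a i) \<bullet> y) * \<bar>f y\<bar> + exp ((l + ?b i) \<bullet> y) * \<bar>f y\<bar>)" .
    moreover have "0 \<le> exp (l \<bullet> y) * (exp (K * norm y) * \<bar>f y\<bar>)"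
      by simp
    ultimately show ?thesis
      unfolding real_norm_def by linarith
  qed
  then show "AE y in lebesgue. norm (exp (l \<bullet> y) * (exp (K * norm y) * \<bar>f y\<bar>))
      \<le> norm (\<Sum>i\<in>UNIV. exp ((l + ?a i) \<bullet> y) * \<bar>f y\<bar> + exp ((l + ?b i) \<bullet> y) * \<bar>f y\<bar>)"
    by (rule AE_I2)
qed

lemma exp_moments_bound:
  fixes f g :: "real ^ 'd \<Rightarrow> real"
  assumes f: "exp_moments f" and K: "K \<ge> 0"
    and g [measurable]: "g \<in> borel_measurable lebesgue"
    and le: "\<And>y. \<bar>g y\<bar> \<le> C * (exp (K * norm y) * \<bar>f y\<bar>)"
  shows "exp_moments g"
  unfolding exp_moments_def
proof (intro conjI allI)
  fix l :: "real ^ 'd"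
  have "integrable lebesgue (\<lambda>y. C * (exp (l \<bullet> y) * (exp (K * norm y) * \<bar>f y\<bar>)))"
    by (intro integrable_mult_right exp_moments_integrable_exp_norm f K)
  then show "integrable lebesgue (\<lambda>y. exp (l \<bullet> y) * \<bar>g y\<bar>)"
  proof (rule Bochner_Integration.integrable_bound)
    have "norm (exp (l \<bullet> y) * \<bar>g y\<bar>) \<le> norm (C * (exp (l \<bullet> y) * (exp (K * norm y) * \<bar>f y\<bar>)))" for y
    proof -
      have "exp (l \<bullet> y) * \<bar>g y\<bar> \<le> C * (exp (l \<bullet> y) * (exp (K * norm y) * \<bar>f y\<bar>))"
        using mult_left_mono[OF le[of y], of "exp (l \<bullet> y)"] by (simp add: mult_ac)
      moreover have "0 \<le> exp (l \<bullet> y) * \<bar>g y\<bar>"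
        by simp
      ultimately show ?thesis
        unfolding real_norm_def by linarith
    qed
    then show "AE y in lebesgue. norm (exp (l \<bullet> y) * \<bar>g y\<bar>)
        \<le> norm (C * (exp (l \<bullet> y) * (exp (K * norm y) * \<bar>f y\<bar>)))"
      by (rule AE_I2)
  qed measurable
qed (rule g)

lemma exp_moments_integrable:
  assumes "exp_moments f"
  shows "integrable lebesgue (\<lambda>y. exp (l \<bullet> y) * f y)"
proof (rule Bochner_Integration.integrable_bound)
  have [measurable]: "f \<in> borel_measurable lebesgue"
    using assms by (simp add: exp_moments_def)
  show "integrable lebesgue (\<lambda>y. exp (l \<bullet> y) * \<bar>f y\<bar>)"
    using assms by (simp add: exp_moments_def)
  show "(\<lambda>y. exp (l \<bullet> y) * f y) \<in> borel_measurable lebesgue"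
    by measurable
qed (simp add: abs_mult)

section \<open>Differentiation under the integral sign\<close>

text \<open>A mean value estimate in which the intermediate exponential is replaced by any
  \<open>m\<close> above both \<open>exp x\<close> and 1. Only an upper bound on
  \<open>exp x\<close> enters, so \<open>x\<close> may be arbitrarily negative, as happens with
  Gaussian exponents.\<close>

lemma abs_exp_minus_one_le:
  fixes x m :: real
  assumes "exp x \<le> m" "1 \<le> m"
  shows "\<bar>exp x - 1\<bar> \<le> \<bar>x\<bar> * m"
proof (cases "x \<ge> 0")
  case True
  have "1 - x \<le> exp (- x)"
    using exp_ge_add_one_self[of "- x"] by simp
  then have "exp x * (1 - x) \<le> exp x * exp (- x)"
    by (intro mult_left_mono) auto
  then have "exp x - 1 \<le> x * exp x"
    by (simp add: algebra_simps flip: exp_add)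
  also have "\<dots> \<le> x * m"
    using True assms by (intro mult_left_mono) auto
  finally show ?thesis
    using True by simp
next
  case False
  have "\<bar>exp x - 1\<bar> \<le> \<bar>x\<bar> * 1"
    using False exp_ge_add_one_self[of x] exp_le_one_iff[of x] by linarith
  also have "\<dots> \<le> \<bar>x\<bar> * m"
    using assms by (intro mult_left_mono) auto
  finally show ?thesis .
qed

text \<open>Dominated convergence, for a general exponent \<open>a\<close> so that both linear
  exponents (derivatives of the transform) and quadratic ones (the heat flow) are covered. The set
  \<open>S\<close> is a parameter because a quadratic exponent with negative leading part is
  controlled only for \<open>s\<close> of one sign.\<close>

lemma exp_moments_difference_quotient:
  fixes f a :: "real ^ 'd \<Rightarrow> real"
  assumes f: "exp_moments f" and a [measurable]: "a \<in> borel_measurable lebesgue"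
    and K: "K \<ge> 0" and M: "M \<ge> 0"
    and a_le: "\<And>y. \<bar>a y\<bar> \<le> C * exp (M * norm y)"
    and exp_le: "\<And>s y. s \<in> S \<Longrightarrow> exp (s * a y) \<le> exp (K * norm y)"
  shows "((\<lambda>s. ((LINT y|lebesgue. exp (\<eta> \<bullet> y) * (exp (s * a y) * f y))
             - (LINT y|lebesgue. exp (\<eta> \<bullet> y) * f y)) / s)
         \<longlongrightarrow> (LINT y|lebesgue. exp (\<eta> \<bullet> y) * (a y * f y))) (at 0 within S)"
  \<comment> \<open>The dominated convergence theorem used below is about sequences, so the limit
    within \<open>S\<close> is tested along sequences.\<close>
  unfolding tendsto_at_iff_sequentially comp_def
proof (intro allI impI)
  have [measurable]: "f \<in> borel_measurable lebesgue"
    using f by (simp add: exp_moments_def)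
  fix s :: "nat \<Rightarrow> real"
  assume sS: "\<forall>n. s n \<in> S - {0}" and s0: "s \<longlonglongrightarrow> 0"
  define q where "q n y = exp (\<eta> \<bullet> y) * ((exp (s n * a y) - 1) / s n * f y)" for n y
  have int_exp: "integrable lebesgue (\<lambda>y. exp (\<eta> \<bullet> y) * (exp (s n * a y) * f y))" for n
  proof (rule exp_moments_integrable, rule exp_moments_bound[OF f K, where C = 1])
    show "\<bar>exp (s n * a y) * f y\<bar> \<le> 1 * (exp (K * norm y) * \<bar>f y\<bar>)" for y
      using exp_le[of "s n" y] sS by (auto simp: abs_mult intro: mult_right_mono)
  qed measurable
  have "(LINT y|lebesgue. q n y) = ((LINT y|lebesgue. exp (\<eta> \<bullet> y) * (exp (s n * a y) * f y))
             - (LINT y|lebesgue. exp (\<eta> \<bullet> y) * f y)) / s n" for n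
  proof -
    have "q n y = (exp (\<eta> \<bullet> y) * (exp (s n * a y) * f y) - exp (\<eta> \<bullet> y) * f y) / s n" for y
      by (simp add: q_def diff_divide_distrib algebra_simps)
    then show ?thesis
      using int_exp exp_moments_integrable[OF f] by simp
  qed
  moreover have "(\<lambda>n. LINT y|lebesgue. q n y) \<longlonglongrightarrow> (LINT y|lebesgue. exp (\<eta> \<bullet> y) * (a y * f y))"
  proof (rule integral_dominated_convergence)
    show "integrable lebesgue (\<lambda>y. C * (exp (\<eta> \<bullet> y) * (exp ((M + K) * norm y) * \<bar>f y\<bar>)))"
      by (intro integrable_mult_right exp_moments_integrable_exp_norm f add_nonneg_nonneg K M)
    show "(\<lambda>y. exp (\<eta> \<bullet> y) * (a y * f y)) \<in> borel_measurable lebesgue"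
      by measurable
    show "q n \<in> borel_measurable lebesgue" for n
      unfolding q_def by measurable
    have "(\<lambda>n. q n y) \<longlonglongrightarrow> exp (\<eta> \<bullet> y) * (a y * f y)" for y
    proof -
      have "((\<lambda>h. exp (h * a y)) has_field_derivative a y) (at 0)"
        by (auto intro!: derivative_eq_intros)
      then have "((\<lambda>h. (exp (h * a y) - 1) / h) \<longlongrightarrow> a y) (at 0)"
        by (simp add: DERIV_def)
      moreover have "filterlim s (at 0) sequentially"
        using s0 sS by (auto simp: filterlim_at)
      ultimately have "(\<lambda>n. (exp (s n * a y) - 1) / s n) \<longlonglongrightarrow> a y"
        by (rule filterlim_compose)
      then show ?thesis
        unfolding q_def by (intro tendsto_intros)
    qed
    then show "AE y in lebesgue. (\<lambda>n. q n y) \<longlonglongrightarrow> exp (\<eta> \<bullet> y) * (a y * f y)"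
      by simp
    \<comment> \<open>The division by \<open>s n\<close> cancels the factor \<open>s n\<close> from
      the mean value estimate, which makes the bound uniform in \<open>n\<close>. Growth
      \<open>M\<close> of \<open>a\<close> and growth \<open>K\<close> of the exponential add
      up.\<close>
    have "norm (q n y) \<le> C * (exp (\<eta> \<bullet> y) * (exp ((M + K) * norm y) * \<bar>f y\<bar>))" for n y
    proof -
      have "\<bar>exp (s n * a y) - 1\<bar> \<le> \<bar>s n * a y\<bar> * exp (K * norm y)"
        using exp_le[of "s n" y] sS K by (intro abs_exp_minus_one_le) auto
      then have "\<bar>(exp (s n * a y) - 1) / s n\<bar> \<le> \<bar>a y\<bar> * exp (K * norm y)"
        using sS by (simp add: abs_mult divide_simps mult_ac)
      also have "\<dots> \<le> C * exp (M * norm y) * exp (K * norm y)"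
        by (intro mult_right_mono a_le) auto
      finally have "\<bar>(exp (s n * a y) - 1) / s n\<bar> \<le> C * exp ((M + K) * norm y)"
        by (simp only: distrib_right exp_add mult.assoc)
      then have "exp (\<eta> \<bullet> y) * (\<bar>(exp (s n * a y) - 1) / s n\<bar> * \<bar>f y\<bar>)
          \<le> exp (\<eta> \<bullet> y) * (C * exp ((M + K) * norm y) * \<bar>f y\<bar>)"
        by (intro mult_left_mono mult_right_mono) auto
      then show ?thesis
        by (simp add: q_def abs_mult mult_ac)
    qed
    then show "AE y in lebesgue. norm (q n y) \<le> C * (exp (\<eta> \<bullet> y) * (exp ((M + K) * norm y) * \<bar>f y\<bar>))" for n
      by simp
  qed
  ultimately show "(\<lambda>n. ((LINT y|lebesgue. exp (\<eta> \<bullet> y) * (exp (s n * a y) * f y))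
             - (LINT y|lebesgue. exp (\<eta> \<bullet> y) * f y)) / s n)
      \<longlonglongrightarrow> (LINT y|lebesgue. exp (\<eta> \<bullet> y) * (a y * f y))"
    by simp
qed

section \<open>Derivatives of the Laplace transform\<close>

lemma abs_inner_le_exp:
  fixes v y :: "'a::real_inner"
  shows "\<bar>v \<bullet> y\<bar> \<le> norm v * exp (1 * norm y)"
proof -
  have "\<bar>v \<bullet> y\<bar> \<le> norm v * norm y"
    by (rule Cauchy_Schwarz_ineq2)
  also have "\<dots> \<le> norm v * exp (1 * norm y)"
    by (intro mult_left_mono) (simp_all add: order_trans[OF _ exp_ge_add_one_self])
  finally show ?thesis .
qed

lemma exp_moments_inner_mult:
  assumes f: "exp_moments f"
  shows "exp_moments (\<lambda>y. (v \<bullet> y) * f y)"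
proof (rule exp_moments_bound[OF f, where K = 1 and C = "norm v"])
  have [measurable]: "f \<in> borel_measurable lebesgue"
    using f by (simp add: exp_moments_def)
  show "(\<lambda>y. (v \<bullet> y) * f y) \<in> borel_measurable lebesgue"
    by measurable
  show "\<bar>(v \<bullet> y) * f y\<bar> \<le> norm v * (exp (1 * norm y) * \<bar>f y\<bar>)" for y
    using mult_right_mono[OF abs_inner_le_exp[of v y], of "\<bar>f y\<bar>"] by (simp add: abs_mult mult_ac)
qed simp

lemma bilateral_laplace_directional_derivative:
  assumes f: "exp_moments f"
  shows "((\<lambda>h. bilateral_laplace f (\<eta> + h *\<^sub>R v)) has_field_derivative
           bilateral_laplace (\<lambda>y. (v \<bullet> y) * f y) \<eta>) (at 0)"
proof -
  have exp_le: "exp (s * (v \<bullet> y)) \<le> exp (norm v * norm y)" if "s \<in> {-1..1}" for s y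
  proof -
    have "s * (v \<bullet> y) \<le> \<bar>s\<bar> * \<bar>v \<bullet> y\<bar>"
      by (metis abs_ge_self abs_mult)
    also have "\<dots> \<le> 1 * (norm v * norm y)"
      using that by (intro mult_mono Cauchy_Schwarz_ineq2) auto
    finally show ?thesis
      by simp
  qed
  \<comment> \<open>For a linear exponent both signs of \<open>s\<close> are harmless, so
    \<open>S\<close> can be a neighbourhood of 0 and the limit is two-sided.\<close>
  have "(0::real) \<in> interior {-1..1}"
    by simp
  then have "at (0::real) within {-1..1} = at 0"
    by (rule at_within_interior)
  then have "((\<lambda>s. ((LINT y|lebesgue. exp (\<eta> \<bullet> y) * (exp (s * (v \<bullet> y)) * f y))
             - (LINT y|lebesgue. exp (\<eta> \<bullet> y) * f y)) / s)
         \<longlongrightarrow> (LINT y|lebesgue. exp (\<eta> \<bullet> y) * ((v \<bullet> y) * f y))) (at 0)"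
    using exp_moments_difference_quotient[OF f _ _ _ abs_inner_le_exp exp_le,
        where \<eta> = \<eta> and S = "{-1..1}"]
    by simp
  then show ?thesis
    by (simp add: DERIV_def bilateral_laplace_def inner_add_left exp_add mult.assoc)
qed

text \<open>An equality of functions rather than of values at a point, so that it can be rewritten a
  second time inside \<open>laplacian\<close>.\<close>

lemma partial_deriv_bilateral_laplace:
  assumes "exp_moments f"
  shows "partial_deriv i (bilateral_laplace f) = bilateral_laplace (\<lambda>y. y $ i * f y)"
proof
  fix \<eta>
  show "partial_deriv i (bilateral_laplace f) \<eta> = bilateral_laplace (\<lambda>y. y $ i * f y) \<eta>"
    using DERIV_imp_deriv[OF bilateral_laplace_directional_derivative[OF assms, of \<eta> "axis i 1"]]
    by (simp add: partial_deriv_def inner_axis')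
qed

lemma continuous_on_bilateral_laplace_line:
  assumes "exp_moments f"
  shows "continuous_on A (\<lambda>r. bilateral_laplace f (\<eta> + r *\<^sub>R v))"
proof (intro continuous_at_imp_continuous_on ballI)
  fix r
  have "isCont (\<lambda>h. bilateral_laplace f ((\<eta> + r *\<^sub>R v) + h *\<^sub>R v)) 0"
    by (rule DERIV_isCont[OF bilateral_laplace_directional_derivative[OF assms]])
  then have "isCont (\<lambda>r'. bilateral_laplace f ((\<eta> + r *\<^sub>R v) + (r' - r) *\<^sub>R v)) r"
    using isCont_o2[of r "\<lambda>r'. r' - r" "\<lambda>h. bilateral_laplace f ((\<eta> + r *\<^sub>R v) + h *\<^sub>R v)"]
    by simp
  then show "isCont (\<lambda>r. bilateral_laplace f (\<eta> + r *\<^sub>R v)) r"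
    by (simp add: algebra_simps)
qed

section \<open>The heat solution as a Laplace transform\<close>

lemma exp_moments_gaussian_mult:
  assumes f: "exp_moments f" and s: "s \<ge> 0"
  shows "exp_moments (\<lambda>y. exp (- (s * (norm y)\<^sup>2)) * f y)"
proof (rule exp_moments_bound[OF f, where K = 0 and C = 1])
  have [measurable]: "f \<in> borel_measurable lebesgue"
    using f by (simp add: exp_moments_def)
  show "(\<lambda>y. exp (- (s * (norm y)\<^sup>2)) * f y) \<in> borel_measurable lebesgue"
    by measurable
  show "\<bar>exp (- (s * (norm y)\<^sup>2)) * f y\<bar> \<le> 1 * (exp (0 * norm y) * \<bar>f y\<bar>)" for y
    using s mult_right_mono[of "exp (- (s * (norm y)\<^sup>2))" 1 "\<bar>f y\<bar>"] by (simp add: abs_mult)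
qed simp

text \<open>Expanding the square in the heat kernel separates a positive factor depending only on
  \<open>t\<close> and \<open>x\<close>. The zeros of the solution are therefore those of the
  transform of the Gaussian-damped datum at \<open>x / (2t)\<close>.\<close>

lemma heat_solution_eq_bilateral_laplace:
  fixes u0 :: "real ^ 'd \<Rightarrow> real"
  assumes "t > 0"
  shows "heat_solution u0 t x =
    (4 * pi * t) powr (- (real CARD('d) / 2)) * exp (- (norm x)\<^sup>2 / (4 * t)) *
      bilateral_laplace (\<lambda>y. exp (- ((1 / (4 * t)) * (norm y)\<^sup>2)) * u0 y) ((1 / (2 * t)) *\<^sub>R x)"
proof -
  have "heat_kernel t (x - y) * u0 y =
      ((4 * pi * t) powr (- (real CARD('d) / 2)) * exp (- (norm x)\<^sup>2 / (4 * t))) *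
      (exp (((1 / (2 * t)) *\<^sub>R x) \<bullet> y) * (exp (- ((1 / (4 * t)) * (norm y)\<^sup>2)) * u0 y))" for y
  proof -
    have "- (norm (x - y))\<^sup>2 / (4 * t) =
        - (norm x)\<^sup>2 / (4 * t) + (((1 / (2 * t)) *\<^sub>R x) \<bullet> y + - ((1 / (4 * t)) * (norm y)\<^sup>2))"
      using assms by (simp add: power2_norm_eq_inner inner_diff inner_commute field_simps)
    then show ?thesis
      by (simp only: heat_kernel_def exp_add mult.assoc)
  qed
  then show ?thesis
    by (simp only: heat_solution_def bilateral_laplace_def integral_mult_right_zero)
qed

text \<open>First-order expansion in \<open>s\<close>: the shift of the argument contributes the
  gradient term, the Gaussian damping the Laplacian term. As the transform vanishes at \<eta>,
  dividing by \<open>s\<close> already forms a difference quotient.\<close>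

lemma bilateral_laplace_gaussian_tendsto:
  fixes f :: "real ^ 'd \<Rightarrow> real"
  assumes f: "exp_moments f" and zero: "bilateral_laplace f \<eta> = 0"
  shows "((\<lambda>s. bilateral_laplace (\<lambda>y. exp (- ((s / 2) * (norm y)\<^sup>2)) * f y) (\<eta> + s *\<^sub>R z) / s)
     \<longlongrightarrow> z \<bullet> grad (bilateral_laplace f) \<eta> - laplacian (bilateral_laplace f) \<eta> / 2)
     (at 0 within {0<..1})"
proof -
  define a where "a y = z \<bullet> y - (norm y)\<^sup>2 / 2" for y :: "real ^ 'd"
  have [measurable]: "a \<in> borel_measurable lebesgue"
    unfolding a_def by measurable
  have a_le: "\<bar>a y\<bar> \<le> (norm z + 1) * exp (1 * norm y)" for y
  proof -
    have "(norm y)\<^sup>2 / 2 \<le> exp (norm y)"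
      using exp_lower_Taylor_quadratic[of "norm y"] norm_ge_zero[of y] by linarith
    moreover have "\<bar>a y\<bar> \<le> \<bar>z \<bullet> y\<bar> + (norm y)\<^sup>2 / 2"
      unfolding a_def by (rule order_trans[OF abs_triangle_ineq4]) simp
    ultimately show ?thesis
      using abs_inner_le_exp[of z y] by (simp add: distrib_right)
  qed
  have exp_le: "exp (s * a y) \<le> exp (norm z * norm y)" if "s \<in> {0<..1}" for s y
  proof -
    have "a y \<le> norm z * norm y"
      unfolding a_def using norm_cauchy_schwarz[of z y] zero_le_power2[of "norm y"] by linarith
    then have "s * a y \<le> s * (norm z * norm y)"
      using that by (intro mult_left_mono) auto
    also have "\<dots> \<le> 1 * (norm z * norm y)"
      using that by (intro mult_right_mono) auto
    finally show ?thesis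
      by simp
  qed
  have "exp ((\<eta> + s *\<^sub>R z) \<bullet> y) * (exp (- ((s / 2) * (norm y)\<^sup>2)) * f y)
      = exp (\<eta> \<bullet> y) * (exp (s * a y) * f y)" for s y
  proof -
    have "(\<eta> + s *\<^sub>R z) \<bullet> y + - ((s / 2) * (norm y)\<^sup>2) = \<eta> \<bullet> y + s * a y"
      by (simp add: a_def inner_add_left algebra_simps)
    then show ?thesis
      by (metis exp_add mult.assoc)
  qed
  then have H: "bilateral_laplace (\<lambda>y. exp (- ((s / 2) * (norm y)\<^sup>2)) * f y) (\<eta> + s *\<^sub>R z)
      = (LINT y|lebesgue. exp (\<eta> \<bullet> y) * (exp (s * a y) * f y))" for s
    by (simp only: bilateral_laplace_def)
  have lim: "((\<lambda>s. bilateral_laplace (\<lambda>y. exp (- ((s / 2) * (norm y)\<^sup>2)) * f y) (\<eta> + s *\<^sub>R z) / s)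
     \<longlongrightarrow> (LINT y|lebesgue. exp (\<eta> \<bullet> y) * (a y * f y))) (at 0 within {0<..1})"
    using exp_moments_difference_quotient[OF f _ _ _ a_le exp_le,
        where \<eta> = \<eta> and S = "{0<..1}"] zero
    unfolding H by (simp add: bilateral_laplace_def)
  have f1: "exp_moments (\<lambda>y. y $ i * f y)" for i
    using exp_moments_inner_mult[OF f, of "axis i 1"] by (simp add: inner_axis')
  have f2: "exp_moments (\<lambda>y. y $ i * (y $ i * f y))" for i
    using exp_moments_inner_mult[OF f1, of "axis i 1"] by (simp add: inner_axis')
  \<comment> \<open>In coordinates the integrand is a combination of first moments, which are the
    partial derivatives, and pure second moments, which sum to the Laplacian.\<close>
  have "exp (\<eta> \<bullet> y) * (a y * f y) = (\<Sum>i\<in>UNIV. z $ i * (exp (\<eta> \<bullet> y) * (y $ i * f y)))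
        - (\<Sum>i\<in>UNIV. exp (\<eta> \<bullet> y) * (y $ i * (y $ i * f y))) / 2" for y
    by (simp add: a_def inner_vec_def power2_norm_eq_inner sum_distrib_left sum_distrib_right
        algebra_simps sum_divide_distrib)
  then have "(LINT y|lebesgue. exp (\<eta> \<bullet> y) * (a y * f y)) =
      z \<bullet> grad (bilateral_laplace f) \<eta> - laplacian (bilateral_laplace f) \<eta> / 2"
    using exp_moments_integrable[OF f1] exp_moments_integrable[OF f2]
    by (simp add: inner_vec_def grad_def laplacian_def partial_deriv_bilateral_laplace f f1 bilateral_laplace_def)
  with lim show ?thesis
    by simp
qed

section \<open>Selecting zeros with vanishing offset\<close>

text \<open>The hypothesis gives a witness for each \<open>e\<close> separately, while one function
  \<open>r\<close> must serve all \<open>e\<close>. Taking \<open>r t\<close> nearly smallest in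
  modulus does this. The slack \<open>1 / t\<close> is there because the infimum need not be
  attained, and it vanishes in the limit.\<close>

lemma near_minimal_selection:
  fixes P :: "real \<Rightarrow> real \<Rightarrow> bool"
  assumes ev: "\<And>e. e > 0 \<Longrightarrow> eventually (\<lambda>t. \<exists>r. P t r \<and> \<bar>r\<bar> \<le> e) at_top"
  obtains T r where "T > 0" "\<And>t. t > T \<Longrightarrow> P t (r t)" "(r \<longlongrightarrow> 0) at_top"
proof -
  have sel: "\<exists>r. P t r \<and> (\<forall>r'. P t r' \<longrightarrow> \<bar>r\<bar> \<le> \<bar>r'\<bar> + 1 / t)" if ex: "\<exists>r. P t r" and t: "t > 0" for t
  proof -
    define m where "m = (INF r\<in>{r. P t r}. \<bar>r\<bar>)"
    have bdd: "bdd_below (abs ` {r. P t r})"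
      by (rule bdd_belowI[of _ 0]) auto
    have m_le: "m \<le> \<bar>r'\<bar>" if "P t r'" for r'
      unfolding m_def using bdd that by (intro cINF_lower) auto
    have "m < m + 1 / t"
      using t by simp
    then obtain r where "P t r" "\<bar>r\<bar> < m + 1 / t"
      using cINF_less_iff[OF _ bdd, of "m + 1 / t"] ex unfolding m_def[symmetric] by auto
    then show ?thesis
      using m_le by fastforce
  qed
  define r where "r t = (SOME r. P t r \<and> (\<forall>r'. P t r' \<longrightarrow> \<bar>r\<bar> \<le> \<bar>r'\<bar> + 1 / t))" for t
  have r: "P t (r t)" "P t r' \<Longrightarrow> \<bar>r t\<bar> \<le> \<bar>r'\<bar> + 1 / t" if "\<exists>r. P t r" "t > 0" for t r'
    using someI_ex[OF sel[OF that]] unfolding r_def by blast+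
  obtain T where "\<forall>t\<ge>T. \<exists>r. P t r \<and> \<bar>r\<bar> \<le> 1"
    using ev[of 1] unfolding eventually_at_top_linorder by auto
  then have T: "\<exists>r. P t r" if "t \<ge> T" for t
    using that by blast
  have "(r \<longlongrightarrow> 0) at_top"
  proof (rule tendstoI)
    fix e :: real
    assume e: "e > 0"
    \<comment> \<open>One half of \<open>e\<close> bounds the competitor \<open>r'\<close>, the
      other absorbs the slack once \<open>t > 2 / e\<close>.\<close>
    have "eventually (\<lambda>t. \<exists>r. P t r \<and> \<bar>r\<bar> \<le> e / 2) at_top"
      using e by (intro ev) simp
    then show "eventually (\<lambda>t. dist (r t) 0 < e) at_top"
      using eventually_gt_at_top[of "2 / e"] eventually_gt_at_top[of 0]
    proof (eventually_elim)
      case (elim t)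
      then obtain r' where "P t r'" "\<bar>r'\<bar> \<le> e / 2"
        by auto
      moreover from this have "\<bar>r t\<bar> \<le> \<bar>r'\<bar> + 1 / t"
        using elim by (intro r(2)) auto
      moreover have "1 / t < e / 2"
        using elim e by (simp add: field_simps)
      ultimately show ?case
        by simp
    qed
  qed
  then show ?thesis
    using T r(1) by (intro that[of "max T 1" r]) auto
qed

section \<open>Asymptotics of the zeros\<close>

theorem theorem4p1:
  fixes u0 :: "real ^ 'd \<Rightarrow> real"
  assumes "CARD('d) \<ge> 2"
    and "integrable lebesgue u0"
    and "\<exists>C. AE y in lebesgue. \<bar>u0 y\<bar> \<le> C"
    and "(LINT y|lebesgue. \<bar>u0 y\<bar>) \<noteq> 0"
    and "\<And>l :: real ^ 'd. integrable lebesgue (\<lambda>y. exp (l \<bullet> y) * \<bar>u0 y\<bar>)"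
    and "zero_set (bilateral_laplace u0) \<noteq> {}"
  shows "\<forall>\<eta> \<in> zero_set (bilateral_laplace u0). multiplicity_one (bilateral_laplace u0) \<eta> \<longrightarrow>
    (\<exists>T > 0. \<exists>x :: real \<Rightarrow> real ^ 'd.
       (\<forall>t > T. x t \<in> zero_level_set u0 t) \<and>
       ((\<lambda>t. x t - ((2 * t) *\<^sub>R \<eta>
           + (laplacian (bilateral_laplace u0) \<eta>
               / (2 * (norm (grad (bilateral_laplace u0) \<eta>))\<^sup>2))
             *\<^sub>R grad (bilateral_laplace u0) \<eta>)) \<longlongrightarrow> 0) at_top)"
proof (intro ballI impI)
  fix \<eta> :: "real ^ 'd"
  assume \<eta>: "\<eta> \<in> zero_set (bilateral_laplace u0)" and mult: "multiplicity_one (bilateral_laplace u0) \<eta>"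
  have u0: "exp_moments u0"
    using assms(2,5) by (auto simp: exp_moments_def)
  define g where "g = grad (bilateral_laplace u0) \<eta>"
  define c where "c = laplacian (bilateral_laplace u0) \<eta> / (2 * (norm g)\<^sup>2)"
  have g0: "g \<noteq> 0"
    using mult by (auto simp: multiplicity_one_def g_def grad_def vec_eq_iff)
  define H where "H s r = bilateral_laplace (\<lambda>y. exp (- ((s / 2) * (norm y)\<^sup>2)) * u0 y)
    (\<eta> + s *\<^sub>R ((c + r) *\<^sub>R g))" for s r
  \<comment> \<open>The value of \<open>c\<close> is the one for which the Laplacian term cancels,
    leaving a limit whose sign is that of \<open>r\<close>.\<close>
  have lim: "((\<lambda>s. H s r / s) \<longlongrightarrow> r * (norm g)\<^sup>2) (at 0 within {0<..1})" for r
  proof -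
    have "((c + r) *\<^sub>R g) \<bullet> grad (bilateral_laplace u0) \<eta> - laplacian (bilateral_laplace u0) \<eta> / 2
        = r * (norm g)\<^sup>2"
      using g0 by (simp add: c_def power2_norm_eq_inner field_simps flip: g_def)
    then show ?thesis
      using bilateral_laplace_gaussian_tendsto[OF u0, of \<eta> "(c + r) *\<^sub>R g"] \<eta>
      unfolding H_def by (simp add: zero_set_def)
  qed
  have s_lim: "filterlim (\<lambda>t::real. 1 / (2 * t)) (at 0 within {0<..1}) at_top"
    unfolding filterlim_at
  proof
    show "\<forall>\<^sub>F t::real in at_top. 1 / (2 * t) \<in> {0<..1} \<and> 1 / (2 * t) \<noteq> 0"
      using eventually_ge_at_top[of 1] by eventually_elim auto
    show "((\<lambda>t::real. 1 / (2 * t)) \<longlongrightarrow> 0) at_top"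
      by (intro tendsto_divide_0[OF tendsto_const] filterlim_at_top_imp_at_infinity
          filterlim_tendsto_pos_mult_at_top[OF tendsto_const] filterlim_ident) auto
  qed
  have "eventually (\<lambda>t. \<exists>r. H (1 / (2 * t)) r = 0 \<and> \<bar>r\<bar> \<le> e) at_top" if e: "e > 0" for e
  proof -
    \<comment> \<open>The limits at \<open>e\<close> and \<open>- e\<close> have opposite strict
      signs, so the quotients, and with them \<open>H\<close> since \<open>s > 0\<close>, eventually
      have these signs too.\<close>
    have "eventually (\<lambda>t. H (1 / (2 * t)) e / (1 / (2 * t)) > 0) at_top"
      using order_tendstoD(1)[OF filterlim_compose[OF lim[of e] s_lim], of 0] e g0 by simp
    moreover have "eventually (\<lambda>t. H (1 / (2 * t)) (- e) / (1 / (2 * t)) < 0) at_top"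
      using order_tendstoD(2)[OF filterlim_compose[OF lim[of "- e"] s_lim], of 0] e g0 by simp
    ultimately show ?thesis
      using eventually_gt_at_top[of 0]
    proof eventually_elim
      case (elim t)
      define s where "s = 1 / (2 * t)"
      have s: "s > 0"
        using elim by (simp add: s_def)
      \<comment> \<open>For fixed \<open>s\<close>, \<open>H s\<close> is a transform restricted to
        the line through \<open>\<eta> + (s * c) *\<^sub>R g\<close> with direction
        \<open>s *\<^sub>R g\<close>.\<close>
      have "continuous_on {- e..e} (H s)"
        using continuous_on_bilateral_laplace_line[OF exp_moments_gaussian_mult[OF u0, of "s / 2"],
            of "{- e..e}" "\<eta> + (s * c) *\<^sub>R g" "s *\<^sub>R g"] s
        unfolding H_def by (simp add: algebra_simps)
      moreover have "H s (- e) \<le> 0" "0 \<le> H s e"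
        using elim s by (simp_all add: s_def[symmetric] divide_less_0_iff zero_less_divide_iff)
      ultimately obtain r where "- e \<le> r" "r \<le> e" "H s r = 0"
        using IVT'[of "H s" "- e" 0 e] e by auto
      then show ?case
        unfolding s_def by (intro exI[of _ r]) auto
    qed
  qed
  then obtain T r where T: "T > 0" and r: "\<And>t. t > T \<Longrightarrow> H (1 / (2 * t)) (r t) = 0" "(r \<longlongrightarrow> 0) at_top"
    using near_minimal_selection[of "\<lambda>t r. H (1 / (2 * t)) r = 0"] by blast
  define x where "x t = (2 * t) *\<^sub>R \<eta> + (c + r t) *\<^sub>R g" for t
  have "x t \<in> zero_level_set u0 t" if "t > T" for t
  proof -
    have "t > 0"
      using that T by simp
    \<comment> \<open>This is the argument of the transform inside \<open>H\<close> at
      \<open>s = 1 / (2 * t)\<close>, and \<open>s / 2\<close> is the Gaussian rate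
      \<open>1 / (4 * t)\<close>. So a zero of \<open>H\<close> is a zero of the heat
      solution.\<close>
    moreover from this have "(1 / (2 * t)) *\<^sub>R x t = \<eta> + (1 / (2 * t)) *\<^sub>R ((c + r t) *\<^sub>R g)"
      by (simp add: x_def scaleR_add_right)
    ultimately show ?thesis
      using r(1)[OF that] by (simp add: zero_level_set_def heat_solution_eq_bilateral_laplace H_def)
  qed
  moreover have "((\<lambda>t. x t - ((2 * t) *\<^sub>R \<eta> + c *\<^sub>R g)) \<longlongrightarrow> 0) at_top"
    using tendsto_scaleR[OF r(2) tendsto_const[of g]] by (simp add: x_def algebra_simps)
  ultimately show "\<exists>T > 0. \<exists>x :: real \<Rightarrow> real ^ 'd.
       (\<forall>t > T. x t \<in> zero_level_set u0 t) \<and>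
       ((\<lambda>t. x t - ((2 * t) *\<^sub>R \<eta>
           + (laplacian (bilateral_laplace u0) \<eta>
               / (2 * (norm (grad (bilateral_laplace u0) \<eta>))\<^sup>2))
             *\<^sub>R grad (bilateral_laplace u0) \<eta>)) \<longlongrightarrow> 0) at_top"
    using T unfolding c_def g_def by blast
qed

end
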